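(* Fix $q\in(0,1)$. For every $\eta>0$, there are an integer $m$ and two all-null score vectors in $\mathbb R^m$ with the same common continuous symmetric (about zero) marginal distribution and the same covariance matrix such that, for the knockoff+ threshold at nominal level $q$: one vector has independent coordinates and FDR at most $q$, while the other is exchangeable and pairwise uncorrelated and has FDR greater than $1-\eta$.
   Context: "All-null" means the set of true nulls is $\mathcal H_0=\{1,\ldots,m\}$. For signed scores $W_1,\ldots,W_m$ and $t>0$, put $N_+(t)=\#\{i:W_i\ge t\}$, $N_-(t)=\#\{i:W_i\le -t\}$, $\mathcal T=\{|W_i|:|W_i|>0\}$. The knockoff+ threshold at level $q$ is $\widehat t=\min\{t\in\mathcal T:(1+N_-(t))/\max(N_+(t),1)\le q\}$, with $\widehat t=\infty$ if the set is empty; the rejection set is $\widehat{\mathcal R}=\{i:W_i\ge\widehat t\}$, and $\mathrm{FDR}=\mathbb E\{|\widehat{\mathcal R}\cap\mathcal H_0|/\max(|\widehat{\mathcal R}|,1)\}$. *)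

theory Defs
  imports "HOL-Probability.Probability"
begin

definition n_pos :: "nat set \<Rightarrow> (nat \<Rightarrow> real) \<Rightarrow> real \<Rightarrow> nat" where
  "n_pos I w t = card {i \<in> I. w i \<ge> t}"

definition n_neg :: "nat set \<Rightarrow> (nat \<Rightarrow> real) \<Rightarrow> real \<Rightarrow> nat" where
  "n_neg I w t = card {i \<in> I. w i \<le> - t}"

definition score_magnitudes :: "nat set \<Rightarrow> (nat \<Rightarrow> real) \<Rightarrow> real set" where
  "score_magnitudes I w = {\<bar>w i\<bar> | i. i \<in> I \<and> \<bar>w i\<bar> > 0}"

definition knockoff_plus_candidates :: "nat set \<Rightarrow> real \<Rightarrow> (nat \<Rightarrow> real) \<Rightarrow> real set" where
  "knockoff_plus_candidates I q w =
     {t \<in> score_magnitudes I w. (1 + real (n_neg I w t)) / real (max (n_pos I w t) 1) \<le> q}"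

definition knockoff_plus_threshold :: "nat set \<Rightarrow> real \<Rightarrow> (nat \<Rightarrow> real) \<Rightarrow> ereal" where
  "knockoff_plus_threshold I q w =
     (if knockoff_plus_candidates I q w = {} then \<infinity>
      else ereal (Min (knockoff_plus_candidates I q w)))"

definition knockoff_plus_rejections :: "nat set \<Rightarrow> real \<Rightarrow> (nat \<Rightarrow> real) \<Rightarrow> nat set" where
  "knockoff_plus_rejections I q w = {i \<in> I. ereal (w i) \<ge> knockoff_plus_threshold I q w}"

text \<open>False discovery rate of the knockoff+ selection; \<open>H0\<close> is the set of true nulls.\<close>

definition knockoff_plus_FDR ::
  "'a measure \<Rightarrow> nat set \<Rightarrow> nat set \<Rightarrow> real \<Rightarrow> (nat \<Rightarrow> 'a \<Rightarrow> real) \<Rightarrow> real" where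
  "knockoff_plus_FDR M I H0 q W =
     (\<integral>\<omega>. (let R = knockoff_plus_rejections I q (\<lambda>i. W i \<omega>)
           in real (card (R \<inter> H0)) / real (max (card R) 1)) \<partial>M)"

definition covariance :: "'a measure \<Rightarrow> ('a \<Rightarrow> real) \<Rightarrow> ('a \<Rightarrow> real) \<Rightarrow> real" where
  "covariance M X Y =
     (\<integral>\<omega>. (X \<omega> - (\<integral>\<omega>'. X \<omega>' \<partial>M)) * (Y \<omega> - (\<integral>\<omega>'. Y \<omega>' \<partial>M)) \<partial>M)"

text \<open>Square integrability makes every entry of the covariance matrix a genuine
  (not a default-valued) integral.\<close>

definition L2_score_vector :: "'a measure \<Rightarrow> nat set \<Rightarrow> (nat \<Rightarrow> 'a \<Rightarrow> real) \<Rightarrow> bool" where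
  "L2_score_vector M I W \<longleftrightarrow> prob_space M \<and>
     (\<forall>i\<in>I. W i \<in> borel_measurable M \<and> integrable M (\<lambda>\<omega>. (W i \<omega>)\<^sup>2))"

definition common_marginal ::
  "'a measure \<Rightarrow> nat set \<Rightarrow> (nat \<Rightarrow> 'a \<Rightarrow> real) \<Rightarrow> real measure \<Rightarrow> bool" where
  "common_marginal M I W \<mu> \<longleftrightarrow> (\<forall>i\<in>I. distr M borel (W i) = \<mu>)"

definition continuous_law :: "real measure \<Rightarrow> bool" where
  "continuous_law \<mu> \<longleftrightarrow> continuous_on UNIV (cdf \<mu>)"

definition symmetric_law :: "real measure \<Rightarrow> bool" where
  "symmetric_law \<mu> \<longleftrightarrow> distr \<mu> borel uminus = \<mu>"

definition joint_law :: "'a measure \<Rightarrow> nat set \<Rightarrow> (nat \<Rightarrow> 'a \<Rightarrow> real) \<Rightarrow> (nat \<Rightarrow> real) measure" where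
  "joint_law M I W = distr M (Pi\<^sub>M I (\<lambda>_. borel)) (\<lambda>\<omega>. \<lambda>i\<in>I. W i \<omega>)"

definition exchangeable :: "'a measure \<Rightarrow> nat set \<Rightarrow> (nat \<Rightarrow> 'a \<Rightarrow> real) \<Rightarrow> bool" where
  "exchangeable M I W \<longleftrightarrow>
     (\<forall>\<pi>. \<pi> permutes I \<longrightarrow> joint_law M I (\<lambda>i. W (\<pi> i)) = joint_law M I W)"

definition pairwise_uncorrelated :: "'a measure \<Rightarrow> nat set \<Rightarrow> (nat \<Rightarrow> 'a \<Rightarrow> real) \<Rightarrow> bool" where
  "pairwise_uncorrelated M I W \<longleftrightarrow>
     (\<forall>i\<in>I. \<forall>j\<in>I. i \<noteq> j \<longrightarrow> covariance M (W i) (W j) = 0)"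

end

theory Submission
  imports Defs
begin

text \<open>
  Take a vector \<open>x\<close> with \<open>b\<close> entries \<open>a > 1\<close> and \<open>n\<close> entries \<open>- 1\<close>, where \<open>b\<close> is at least
  \<open>1 / q\<close> and \<open>n\<close> at least \<open>(b + 1) / q\<close>. Then both \<open>x\<close> and \<open>- x\<close> lead to a rejection, at the
  thresholds \<open>a\<close> and \<open>1\<close>. Put \<open>W\<^sub>i = U * x\<^bsub>\<sigma> i\<^esub>\<close> with \<open>\<sigma>\<close> a uniform random permutation and \<open>U\<close>
  uniform on \<open>[-1, 1]\<close>: as knockoff+ is scale invariant, something is rejected almost surely, so
  the FDR is 1. The number \<open>a\<close> solves \<open>(\<Sum>x\<^sub>i)\<^sup>2 = \<Sum>x\<^sub>i\<^sup>2\<close>, which says that the off-diagonal products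
  \<open>W\<^sub>i * W\<^sub>j\<close> sum to zero; by exchangeability each of them has mean zero.

  For independent coordinates with the same symmetric law, the signs are fair coins given the
  magnitudes. A rejection makes the walk \<open>q * N\<^sub>+ - N\<^sub>-\<close>, read along decreasing magnitudes, reach the
  level 1, and by the exponential supermartingale \<open>q powr (- walk)\<close> this has probability at most \<open>q\<close>.
\<close>

section \<open>Sign flips and the walk read along decreasing magnitudes\<close>

text \<open>As \<open>t\<close> decreases from infinity, \<open>q * N\<^sub>+ - N\<^sub>-\<close>
  performs a walk; the level to be reached is \<open>d\<close>. Because \<open>t\<close> runs over
  all positive reals and not only over magnitudes, the starting value 0 of the walk counts as well,
  also for empty \<open>I\<close>.\<close>

definition crossing :: "real \<Rightarrow> nat set \<Rightarrow> (nat \<Rightarrow> real) \<Rightarrow> real \<Rightarrow> bool" where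
  "crossing q I w d \<longleftrightarrow> (\<exists>t>0. d \<le> q * real (n_pos I w t) - real (n_neg I w t))"

text \<open>Letting \<open>A\<close> range over all subsets of \<open>I\<close> while the magnitudes
  stay fixed turns fair coin signs into a count of subsets.\<close>

definition flip_signs :: "nat set \<Rightarrow> (nat \<Rightarrow> real) \<Rightarrow> nat \<Rightarrow> real" where
  "flip_signs A w i = (if i \<in> A then - w i else w i)"

lemma n_pos_cong: "(\<And>i. i \<in> I \<Longrightarrow> v i = w i) \<Longrightarrow> n_pos I v t = n_pos I w t"
  unfolding n_pos_def by (rule arg_cong[where f = card]) auto

lemma n_neg_cong: "(\<And>i. i \<in> I \<Longrightarrow> v i = w i) \<Longrightarrow> n_neg I v t = n_neg I w t"
  unfolding n_neg_def by (rule arg_cong[where f = card]) auto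

lemma crossing_cong: "(\<And>i. i \<in> I \<Longrightarrow> v i = w i) \<Longrightarrow> crossing q I v d = crossing q I w d"
  unfolding crossing_def using n_pos_cong[of I v w] n_neg_cong[of I v w] by simp

lemma n_pos_insert:
  assumes "finite S" "x \<notin> S"
  shows "n_pos (insert x S) w t = n_pos S w t + (if w x \<ge> t then 1 else 0)"
proof -
  have "{i \<in> insert x S. w i \<ge> t} = (if w x \<ge> t then insert x {i \<in> S. w i \<ge> t} else {i \<in> S. w i \<ge> t})"
    by auto
  then show ?thesis using assms by (simp add: n_pos_def)
qed

lemma n_neg_insert:
  assumes "finite S" "x \<notin> S"
  shows "n_neg (insert x S) w t = n_neg S w t + (if w x \<le> - t then 1 else 0)"
proof -
  have "{i \<in> insert x S. w i \<le> - t} = (if w x \<le> - t then insert x {i \<in> S. w i \<le> - t} else {i \<in> S. w i \<le> - t})"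
    by auto
  then show ?thesis using assms by (simp add: n_neg_def)
qed

text \<open>Lowering the threshold reveals the largest magnitude first, so the walk
  \<open>q * N\<^sub>+ - N\<^sub>-\<close> starts with the sign of that coordinate.\<close>

lemma crossing_insert_largest:
  assumes "finite S" "x \<notin> S" "\<And>y. y \<in> S \<Longrightarrow> \<bar>v y\<bar> \<le> \<bar>v x\<bar>"
    and "0 < d" and cr: "crossing q (insert x S) v d"
  shows "0 \<le> v x \<Longrightarrow> crossing q S v (d - q)" and "v x \<le> 0 \<Longrightarrow> crossing q S v (d + 1)"
proof -
  obtain t where t: "t > 0" "d \<le> q * real (n_pos (insert x S) v t) - real (n_neg (insert x S) v t)"
    using cr by (auto simp: crossing_def)
  \<comment> \<open>A positive level needs a positive \<open>n_pos\<close>, so \<open>t\<close> is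
    at most the largest magnitude \<open>\<bar>v x\<bar>\<close> and \<open>x\<close> is already
    counted at \<open>t\<close>. Removing \<open>x\<close> then shifts the level still to be reached
    by exactly its own step. The case \<open>v x = 0\<close> is excluded by
    \<open>0 < t\<close>.\<close>
  have "n_pos (insert x S) v t \<noteq> 0"
    using t(2) \<open>0 < d\<close> by (intro notI) simp
  then obtain i where "i \<in> insert x S" "v i \<ge> t"
    unfolding n_pos_def by (metis (mono_tags, lifting) card.empty empty_Collect_eq)
  then have tx: "t \<le> \<bar>v x\<bar>" using assms(3) by fastforce
  show "crossing q S v (d - q)" if "0 \<le> v x"
    using t tx that n_pos_insert[OF assms(1,2), of v t] n_neg_insert[OF assms(1,2), of v t]
    unfolding crossing_def by (intro exI[of _ t]) (auto simp: algebra_simps)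
  show "crossing q S v (d + 1)" if "v x \<le> 0"
    using t tx that n_pos_insert[OF assms(1,2), of v t] n_neg_insert[OF assms(1,2), of v t]
    unfolding crossing_def by (intro exI[of _ t]) (auto simp: algebra_simps)
qed

text \<open>Supermartingale inequality for one step: the left-hand side is twice the mean of
  \<open>q powr (- s)\<close> over a fair step \<open>s\<close> equal to \<open>q\<close> or
  \<open>- 1\<close>. In logarithms it reads \<open>0 \<le> ln (2 - q) + q * ln q\<close>. This
  function of \<open>q\<close> vanishes at 1 together with its derivative and is convex on the
  interval from 0 to 1, hence nonnegative there.\<close>

lemma powr_self_neg_le:
  fixes q :: real
  assumes "0 < q" "q < 1"
  shows "q powr (- q) + q \<le> 2"
proof -
  define h where "h x = ln (2 - x) + x * ln x" for x :: real
  define h' where "h' x = ln x + 1 - 1 / (2 - x)" for x :: real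
  have h'_nonpos: "h' x \<le> 0" if "0 < x" "x \<le> 1" for x
  proof -
    have "\<exists>y. (h' has_real_derivative y) (at z) \<and> y \<ge> 0" if "x \<le> z" "z \<le> 1" for z
    proof (intro exI conjI)
      show "(h' has_real_derivative (1 / z - 1 / (2 - z)\<^sup>2)) (at z)"
        unfolding h'_def using that \<open>0 < x\<close>
        by (auto intro!: derivative_eq_intros simp: power2_eq_square field_simps)
      have "(2 - z)\<^sup>2 - z = (1 - z) * (4 - z)" by (simp add: power2_eq_square algebra_simps)
      moreover have "0 \<le> (1 - z) * (4 - z)" using that by simp
      ultimately have "z \<le> (2 - z)\<^sup>2" by linarith
      then show "0 \<le> 1 / z - 1 / (2 - z)\<^sup>2"
        using that \<open>0 < x\<close> by (simp add: frac_le)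
    qed
    from DERIV_nonneg_imp_nondecreasing[OF \<open>x \<le> 1\<close> this] have "h' x \<le> h' 1" .
    then show ?thesis by (simp add: h'_def)
  qed
  have "\<exists>y. (h has_real_derivative y) (at z) \<and> y \<le> 0" if "q \<le> z" "z \<le> 1" for z
  proof (intro exI conjI)
    show "(h has_real_derivative h' z) (at z)"
      unfolding h_def h'_def using that \<open>0 < q\<close>
      by (auto intro!: derivative_eq_intros simp: field_simps)
    show "h' z \<le> 0" using h'_nonpos that \<open>0 < q\<close> by simp
  qed
  from DERIV_nonpos_imp_nonincreasing[OF less_imp_le[OF \<open>q < 1\<close>] this]
  have "0 \<le> ln (2 - q) + q * ln q" by (simp add: h_def)
  then have "exp (- q * ln q) \<le> exp (ln (2 - q))" by simp
  then show ?thesis using assms by (simp add: powr_def)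
qed

text \<open>\<open>q powr d\<close> is a supersolution of the recursion for the crossing probability of the
  walk with steps \<open>q\<close> and \<open>- 1\<close>.\<close>

lemma card_crossing_flips_le:
  fixes w :: "nat \<Rightarrow> real"
  assumes q: "0 < q" "q < 1" and "finite I"
  shows "real (card {A \<in> Pow I. crossing q I (flip_signs A w) d}) \<le> 2 ^ card I * q powr d"
  using \<open>finite I\<close>
\<comment> \<open>Inserting coordinates in order of increasing magnitude makes the inserted one the
  first step of the walk. The level has to vary because that step replaces \<open>d\<close> by
  \<open>d - q\<close> or \<open>d + 1\<close>.\<close>
proof (induction arbitrary: d rule: finite_ranking_induct[where f = "\<lambda>i. \<bar>w i\<bar>"])
  case empty
  show ?case
  proof (cases "d \<le> 0")
    case True
    then have "1 \<le> q powr d" using q powr_mono'[of d 0 q] by simp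
    moreover have "card {A \<in> Pow {}. crossing q {} (flip_signs A w) d} \<le> card (Pow ({}::nat set))"
      by (intro card_mono) auto
    ultimately show ?thesis by simp
  next
    case False
    then have "{A \<in> Pow {}. crossing q {} (flip_signs A w) d} = {}"
      by (auto simp: crossing_def n_pos_def n_neg_def)
    then show ?thesis by (simp only: card.empty) simp
  qed
next
  case (insert x S)
  \<comment> \<open>For a nonpositive level the bound is at least the number of all subsets, so only
    positive levels need the recursion.\<close>
  show ?case
  proof (cases "d \<le> 0")
    case True
    then have "1 \<le> q powr d" using q powr_mono'[of d 0 q] by simp
    moreover have "card {A \<in> Pow (insert x S). crossing q (insert x S) (flip_signs A w) d}
        \<le> card (Pow (insert x S))"
      using insert by (intro card_mono) auto
    then have "real (card {A \<in> Pow (insert x S). crossing q (insert x S) (flip_signs A w) d})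
        \<le> 2 ^ card (insert x S)"
      using insert by (simp add: card_Pow del: card_insert_disjoint)
    ultimately show ?thesis
      by (smt (verit, ccfv_SIG) mult_left_le mult_le_cancel_left1 zero_le_power)
  next
    case False
    \<comment> \<open>The ranking induction does not guarantee that the inserted index is
      new.\<close>
    show ?thesis
    proof (cases "x \<in> S")
      case True
      then show ?thesis using insert.IH[of d] by (simp add: insert_absorb)
    next
      case xS: False
      let ?P = "\<lambda>A. crossing q (insert x S) (flip_signs A w) d"
      let ?C = "\<lambda>e. {A \<in> Pow S. crossing q S (flip_signs A w) e}"
      have fin: "finite (?C e)" for e using insert by simp
      have restr: "crossing q S (flip_signs (insert x A) w) e = crossing q S (flip_signs A w) e" for A e
        using xS by (intro crossing_cong) (auto simp: flip_signs_def)
      have step: "(0 \<le> flip_signs A w x \<longrightarrow> crossing q S (flip_signs A w) (d - q)) \<and>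
          (flip_signs A w x \<le> 0 \<longrightarrow> crossing q S (flip_signs A w) (d + 1))" if "?P A" for A
        using crossing_insert_largest[of S x "flip_signs A w" d q] insert xS q False that
        by (auto simp: flip_signs_def)
      \<comment> \<open>Subsets are paired as \<open>A\<close> and \<open>insert x A\<close>. One
        member of the pair gives \<open>x\<close> a nonnegative sign and leaves level
        \<open>d - q\<close>, the other a nonpositive sign and leaves level \<open>d + 1\<close>;
        which one is which depends on the sign of \<open>w x\<close>.\<close>
      have unflipped: "(0 \<le> w x \<longrightarrow> A \<in> ?C (d - q)) \<and> (w x \<le> 0 \<longrightarrow> A \<in> ?C (d + 1))"
        if "A \<in> Pow S" "?P A" for A
      proof -
        have "flip_signs A w x = w x" using that(1) xS by (auto simp: flip_signs_def)
        then show ?thesis using step[OF that(2)] that(1) by simp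
      qed
      have flipped: "(w x \<le> 0 \<longrightarrow> A \<in> ?C (d - q)) \<and> (0 \<le> w x \<longrightarrow> A \<in> ?C (d + 1))"
        if "A \<in> Pow S" "?P (insert x A)" for A
      proof -
        have "flip_signs (insert x A) w x = - w x" by (simp add: flip_signs_def)
        then show ?thesis using step[OF that(2)] that(1) restr by simp
      qed
      have split: "{A \<in> Pow (insert x S). ?P A}
          = {A \<in> Pow S. ?P A} \<union> insert x ` {A \<in> Pow S. ?P (insert x A)}"
        unfolding Pow_insert by auto
      have "card {A \<in> Pow (insert x S). ?P A}
          \<le> card {A \<in> Pow S. ?P A} + card {A \<in> Pow S. ?P (insert x A)}"
        unfolding split using insert(1)
        by (intro order_trans[OF card_Un_le] add_mono order_refl card_image_le) simp
      also have "\<dots> \<le> card (?C (d - q)) + card (?C (d + 1))"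
      proof (cases "0 \<le> w x")
        case True
        have "{A \<in> Pow S. ?P A} \<subseteq> ?C (d - q)" using unflipped True by blast
        moreover have "{A \<in> Pow S. ?P (insert x A)} \<subseteq> ?C (d + 1)" using flipped True by blast
        ultimately show ?thesis by (intro add_mono card_mono fin)
      next
        case False
        then have "w x \<le> 0" by simp
        have "{A \<in> Pow S. ?P A} \<subseteq> ?C (d + 1)" using unflipped \<open>w x \<le> 0\<close> by blast
        moreover have "{A \<in> Pow S. ?P (insert x A)} \<subseteq> ?C (d - q)" using flipped \<open>w x \<le> 0\<close> by blast
        ultimately show ?thesis by (subst add.commute) (intro add_mono card_mono fin)
      qed
      finally have "real (card {A \<in> Pow (insert x S). ?P A})
          \<le> real (card (?C (d - q))) + real (card (?C (d + 1)))" by linarith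
      also have "\<dots> \<le> 2 ^ card S * q powr (d - q) + 2 ^ card S * q powr (d + 1)"
        using insert.IH by (intro add_mono)
      also have "\<dots> = 2 ^ card S * q powr d * (q powr (- q) + q)"
        using q by (simp add: powr_add powr_diff powr_minus field_simps)
      also have "\<dots> \<le> 2 ^ card S * q powr d * 2"
        using powr_self_neg_le[OF q] by (intro mult_left_mono) auto
      also have "\<dots> = 2 ^ card (insert x S) * q powr d"
        using insert(1) xS by simp
      finally show ?thesis .
    qed
  qed
qed

section \<open>The all-null FDR as the probability of a rejection\<close>

lemma knockoff_plus_candidates_nonempty_iff:
  "knockoff_plus_candidates I q w \<noteq> {} \<longleftrightarrow>
    (\<exists>i\<in>I. 0 < \<bar>w i\<bar> \<and> 1 + real (n_neg I w \<bar>w i\<bar>) \<le> q * real (max (n_pos I w \<bar>w i\<bar>) 1))"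
  by (auto simp: knockoff_plus_candidates_def score_magnitudes_def pos_divide_le_eq)

text \<open>Every rejection is false, so the proportion is 1 as soon as anything is rejected. A
  candidate threshold does force a rejection: with no score at or above it, the ratio would be at
  least 1, hence larger than \<open>q\<close>.\<close>

lemma false_discovery_proportion_all_null:
  assumes "finite I" "q < 1"
  shows "(let R = knockoff_plus_rejections I q w in real (card (R \<inter> I)) / real (max (card R) 1))
      = of_bool (knockoff_plus_candidates I q w \<noteq> {})"
proof -
  define R where "R = knockoff_plus_rejections I q w"
  have R: "R \<subseteq> I" "finite R"
    using assms by (auto simp: R_def knockoff_plus_rejections_def)
  have "R \<noteq> {}" if ne: "knockoff_plus_candidates I q w \<noteq> {}"
  proof -
    have "finite (score_magnitudes I w)"
      unfolding score_magnitudes_def using assms by simp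
    then have fin: "finite (knockoff_plus_candidates I q w)"
      by (simp add: knockoff_plus_candidates_def)
    define t where "t = Min (knockoff_plus_candidates I q w)"
    have "t \<in> knockoff_plus_candidates I q w"
      unfolding t_def using fin ne by (rule Min_in)
    then have "1 + real (n_neg I w t) \<le> q * real (max (n_pos I w t) 1)"
      by (simp add: knockoff_plus_candidates_def pos_divide_le_eq)
    then have "n_pos I w t \<noteq> 0" using \<open>q < 1\<close> by (intro notI) simp
    then obtain i where "i \<in> I" "t \<le> w i"
      unfolding n_pos_def by (metis (mono_tags, lifting) card.empty empty_Collect_eq)
    then have "i \<in> R"
      using ne by (simp add: R_def knockoff_plus_rejections_def knockoff_plus_threshold_def t_def)
    then show ?thesis by auto
  qed
  moreover have "R = {}" if "knockoff_plus_candidates I q w = {}"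
    using that by (simp add: R_def knockoff_plus_rejections_def knockoff_plus_threshold_def)
  moreover have "R \<inter> I = R" using R by auto
  moreover have "real (card R) / real (max (card R) 1) = of_bool (R \<noteq> {})"
  proof (cases "R = {}")
    case False
    then have "0 < card R" using R by (simp add: card_gt_0_iff)
    then have "max (card R) 1 = card R" by simp
    then show ?thesis using False \<open>0 < card R\<close> by simp
  qed simp
  ultimately show ?thesis
    unfolding R_def[symmetric] Let_def by (cases "knockoff_plus_candidates I q w = {}") simp_all
qed

lemma knockoff_plus_FDR_all_null:
  assumes "finite I" "q < 1"
  shows "knockoff_plus_FDR M I I q W
      = (\<integral>\<omega>. of_bool (knockoff_plus_candidates I q (\<lambda>i. W i \<omega>) \<noteq> {}) \<partial>M)"
  unfolding knockoff_plus_FDR_def false_discovery_proportion_all_null[OF assms] ..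

text \<open>Clearing the denominator at a candidate magnitude gives the crossing; level 1 is the
  extra 1 in the numerator of the knockoff+ ratio. Again \<open>q < 1\<close> forces
  \<open>n_pos\<close> to be positive, which removes the maximum with 1.\<close>

lemma crossing_one_if_candidate:
  assumes "q < 1" "knockoff_plus_candidates I q w \<noteq> {}"
  shows "crossing q I w 1"
proof -
  obtain i where i: "0 < \<bar>w i\<bar>"
      "1 + real (n_neg I w \<bar>w i\<bar>) \<le> q * real (max (n_pos I w \<bar>w i\<bar>) 1)"
    using assms(2) unfolding knockoff_plus_candidates_nonempty_iff by blast
  have "n_pos I w \<bar>w i\<bar> \<noteq> 0" using i(2) \<open>q < 1\<close> by (intro notI) simp
  then have "max (n_pos I w \<bar>w i\<bar>) 1 = n_pos I w \<bar>w i\<bar>" by simp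
  then show ?thesis unfolding crossing_def using i by (intro exI[of _ "\<bar>w i\<bar>"]) auto
qed

text \<open>The counting bound at level 1, where \<open>q powr d\<close> becomes the nominal level
  itself.\<close>

lemma sum_flips_candidates_le:
  assumes "0 < q" "q < 1" "finite I"
  shows "(\<Sum>A\<in>Pow I. of_bool (knockoff_plus_candidates I q (flip_signs A w) \<noteq> {})) \<le> 2 ^ card I * q"
proof -
  have "(\<Sum>A\<in>Pow I. of_bool (knockoff_plus_candidates I q (flip_signs A w) \<noteq> {}))
      = real (card {A \<in> Pow I. knockoff_plus_candidates I q (flip_signs A w) \<noteq> {}})"
    using assms by (simp add: of_bool_def sum.If_cases Int_def)
  also have "\<dots> \<le> real (card {A \<in> Pow I. crossing q I (flip_signs A w) 1})"
    using assms crossing_one_if_candidate by (intro of_nat_mono card_mono) auto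
  also have "\<dots> \<le> 2 ^ card I * q"
    using card_crossing_flips_le[OF assms, of w 1] assms by simp
  finally show ?thesis .
qed

section \<open>Independent symmetric coordinates: sign invariance and the FDR bound\<close>

text \<open>The product measure is determined by boxes. The preimage of a box is the box with its
  sides in \<open>A\<close> reflected, and by symmetry of \<open>\<mu>\<close> each reflected side
  keeps its measure.\<close>

lemma distr_PiM_flip_signs:
  assumes "finite I" "prob_space \<mu>" "sets \<mu> = sets borel" "distr \<mu> borel uminus = \<mu>"
  shows "distr (PiM I (\<lambda>_. \<mu>)) (PiM I (\<lambda>_. \<mu>)) (\<lambda>\<omega>. \<lambda>i\<in>I. flip_signs A \<omega> i) = PiM I (\<lambda>_. \<mu>)"
    (is "distr ?M ?M ?F = ?M")
proof -
  interpret \<mu>: prob_space \<mu> by fact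
  interpret product_prob_space "\<lambda>_. \<mu>" I by unfold_locales
  interpret finite_product_prob_space "\<lambda>_. \<mu>" I by unfold_locales fact
  have uminus_meas: "uminus \<in> measurable \<mu> \<mu>"
    using assms(3) by (simp cong: measurable_cong_sets)
  have F: "?F \<in> measurable ?M ?M"
  proof (rule measurable_restrict)
    fix i assume "i \<in> I"
    then show "(\<lambda>\<omega>. flip_signs A \<omega> i) \<in> measurable ?M \<mu>"
      using measurable_compose[OF measurable_component_singleton[OF \<open>i \<in> I\<close>, of "\<lambda>_. \<mu>"] uminus_meas]
      by (cases "i \<in> A") (auto simp: flip_signs_def)
  qed
  have sp: "space \<mu> = UNIV" using sets_eq_imp_space_eq[OF assms(3)] by simp
  show ?thesis
  proof (rule PiM_eqI)
    fix X assume X: "\<And>i. i \<in> I \<Longrightarrow> X i \<in> sets \<mu>"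
    define Y where "Y i = (if i \<in> A then uminus -` X i else X i)" for i
    have Y: "Y i \<in> sets \<mu>" "emeasure \<mu> (Y i) = emeasure \<mu> (X i)" if "i \<in> I" for i
    proof -
      show "Y i \<in> sets \<mu>"
        using X[OF that] measurable_sets[OF uminus_meas X[OF that]] sp by (simp add: Y_def)
      have "emeasure \<mu> (uminus -` X i) = emeasure (distr \<mu> borel uminus) (X i)"
        using X[OF that] assms(3) sp by (subst emeasure_distr) (auto cong: measurable_cong_sets)
      then show "emeasure \<mu> (Y i) = emeasure \<mu> (X i)" using assms(4) by (simp add: Y_def)
    qed
    have "?F -` Pi\<^sub>E I X \<inter> space ?M = Pi\<^sub>E I Y"
      by (auto simp: space_PiM sp PiE_iff flip_signs_def Y_def split: if_splits)
    then have "emeasure (distr ?M ?M ?F) (Pi\<^sub>E I X) = emeasure ?M (Pi\<^sub>E I Y)"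
      using X \<open>finite I\<close> by (subst emeasure_distr[OF F]) (auto intro!: sets_PiM_I_finite)
    also have "\<dots> = (\<Prod>i\<in>I. emeasure \<mu> (X i))"
      using Y \<open>finite I\<close> by (subst emeasure_PiM) (auto intro!: prod.cong)
    finally show "emeasure (distr ?M ?M ?F) (Pi\<^sub>E I X) = (\<Prod>i\<in>I. emeasure \<mu> (X i))" .
  qed (use assms in auto)
qed

lemma knockoff_plus_candidates_cong:
  assumes "\<And>i. i \<in> I \<Longrightarrow> v i = w i"
  shows "knockoff_plus_candidates I q v = knockoff_plus_candidates I q w"
proof -
  have "score_magnitudes I v = score_magnitudes I w"
    unfolding score_magnitudes_def by (rule Collect_cong) (metis assms)
  then show ?thesis
    unfolding knockoff_plus_candidates_def
    using n_pos_cong[of I v w] n_neg_cong[of I v w] assms by simp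
qed

lemma n_pos_measurable:
  assumes "finite I" "\<And>i. i \<in> I \<Longrightarrow> (\<lambda>\<omega>. w \<omega> i) \<in> borel_measurable M" "t \<in> borel_measurable M"
  shows "(\<lambda>\<omega>. real (n_pos I (w \<omega>) (t \<omega>))) \<in> borel_measurable M"
proof -
  have "real (n_pos I (w \<omega>) (t \<omega>)) = (\<Sum>i\<in>I. if t \<omega> \<le> w \<omega> i then 1 else 0)" for \<omega>
    using assms(1) by (simp add: n_pos_def sum.If_cases Int_def)
  then show ?thesis using assms by simp
qed

lemma n_neg_measurable:
  assumes "finite I" "\<And>i. i \<in> I \<Longrightarrow> (\<lambda>\<omega>. w \<omega> i) \<in> borel_measurable M" "t \<in> borel_measurable M"
  shows "(\<lambda>\<omega>. real (n_neg I (w \<omega>) (t \<omega>))) \<in> borel_measurable M"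
proof -
  have "real (n_neg I (w \<omega>) (t \<omega>)) = (\<Sum>i\<in>I. if w \<omega> i \<le> - t \<omega> then 1 else 0)" for \<omega>
    using assms(1) by (simp add: n_neg_def sum.If_cases Int_def)
  then show ?thesis using assms by simp
qed

text \<open>A finite disjunction over coordinates takes the place of the random set of magnitudes,
  and the counts in it are finite sums of indicators.\<close>

lemma candidates_nonempty_measurable:
  assumes "finite I" "\<And>i. i \<in> I \<Longrightarrow> (\<lambda>\<omega>. w \<omega> i) \<in> borel_measurable M"
  shows "(\<lambda>\<omega>. of_bool (knockoff_plus_candidates I q (w \<omega>) \<noteq> {}) :: real) \<in> borel_measurable M"
proof -
  have [measurable]: "(\<lambda>\<omega>. w \<omega> i) \<in> borel_measurable M" if "i \<in> I" for i
    using assms(2) that .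
  have [measurable]: "(\<lambda>\<omega>. real (n_pos I (w \<omega>) \<bar>w \<omega> i\<bar>)) \<in> borel_measurable M"
    "(\<lambda>\<omega>. real (n_neg I (w \<omega>) \<bar>w \<omega> i\<bar>)) \<in> borel_measurable M" if "i \<in> I" for i
    using assms that by (intro n_pos_measurable n_neg_measurable borel_measurable_abs; simp)+
  have max: "real (max (n_pos I (w \<omega>) s) 1) = max (real (n_pos I (w \<omega>) s)) 1" for \<omega> s
    by (simp add: max_def)
  have "Measurable.pred M (\<lambda>\<omega>. knockoff_plus_candidates I q (w \<omega>) \<noteq> {})"
    unfolding knockoff_plus_candidates_nonempty_iff max using \<open>finite I\<close>
    by measurable
  then show ?thesis by measurable
qed

text \<open>Sign flips preserve the product law, so the rejection probability equals its average
  over all \<open>2 ^ card I\<close> flips. After exchanging sum and integral, the counting bound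
  applies to each outcome separately.\<close>

lemma knockoff_plus_FDR_independent_symmetric_le:
  assumes q: "0 < q" "q < 1" and "finite I"
    and \<mu>: "prob_space \<mu>" "sets \<mu> = sets borel" "distr \<mu> borel uminus = \<mu>"
  shows "knockoff_plus_FDR (PiM I (\<lambda>_. \<mu>)) I I q (\<lambda>i \<omega>. \<omega> i) \<le> q"
proof -
  let ?M = "PiM I (\<lambda>_. \<mu>)"
  let ?g = "\<lambda>\<omega>. of_bool (knockoff_plus_candidates I q \<omega> \<noteq> {}) :: real"
  let ?F = "\<lambda>A \<omega>. \<lambda>i\<in>I. flip_signs A \<omega> i"
  interpret \<mu>: prob_space \<mu> by fact
  interpret M: prob_space ?M by (intro prob_space_PiM \<mu>)
  have comp: "(\<lambda>\<omega>. \<omega> i) \<in> borel_measurable ?M" if "i \<in> I" for i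
    using measurable_component_singleton[OF that, of "\<lambda>_. \<mu>"] \<mu>(2) by (simp cong: measurable_cong_sets)
  have g: "?g \<in> borel_measurable ?M"
    using candidates_nonempty_measurable[where w = "\<lambda>\<omega>. \<omega>"] \<open>finite I\<close> comp by blast
  have flip_comp: "(\<lambda>\<omega>. flip_signs A \<omega> i) \<in> borel_measurable ?M" if "i \<in> I" for A i
    using comp[OF that] by (cases "i \<in> A") (auto simp: flip_signs_def)
  have flip_meas: "?F A \<in> measurable ?M ?M" for A
    using flip_comp \<mu>(2) by (intro measurable_restrict) (simp cong: measurable_cong_sets)
  have g_flip: "?g (?F A \<omega>) = ?g (flip_signs A \<omega>)" for A \<omega>
    using knockoff_plus_candidates_cong[of I "?F A \<omega>" "flip_signs A \<omega>" q] by simp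
  have inv: "(\<integral>\<omega>. ?g \<omega> \<partial>?M) = (\<integral>\<omega>. ?g (flip_signs A \<omega>) \<partial>?M)" for A
    using integral_distr[OF flip_meas g, of A] distr_PiM_flip_signs[OF \<open>finite I\<close> \<mu>, of A] g_flip
    by simp
  have int: "integrable ?M (\<lambda>\<omega>. ?g (flip_signs A \<omega>))" for A
    using candidates_nonempty_measurable[where w = "flip_signs A"] \<open>finite I\<close> flip_comp
    by (intro M.integrable_const_bound[where B = 1]) auto
  have "2 ^ card I * (\<integral>\<omega>. ?g \<omega> \<partial>?M) = (\<Sum>A\<in>Pow I. \<integral>\<omega>. ?g (flip_signs A \<omega>) \<partial>?M)"
    using \<open>finite I\<close> by (simp add: inv[symmetric] card_Pow)
  also have "\<dots> = (\<integral>\<omega>. (\<Sum>A\<in>Pow I. ?g (flip_signs A \<omega>)) \<partial>?M)"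
    using int by (intro Bochner_Integration.integral_sum[symmetric])
  also have "\<dots> \<le> (\<integral>\<omega>. 2 ^ card I * q \<partial>?M)"
    using int sum_flips_candidates_le[OF q \<open>finite I\<close>]
    by (intro integral_mono Bochner_Integration.integrable_sum) auto
  also have "\<dots> = 2 ^ card I * q" by (simp add: M.prob_space)
  finally have "(\<integral>\<omega>. ?g \<omega> \<partial>?M) \<le> q" by simp
  then show ?thesis by (simp add: knockoff_plus_FDR_all_null[OF \<open>finite I\<close> q(2)])
qed

section \<open>Scale and permutation invariance, and the two-level vector\<close>

lemma n_pos_scaled_permutation:
  assumes "\<sigma> permutes I" "0 < u"
  shows "n_pos I (\<lambda>i. u * x (\<sigma> i)) (u * t) = n_pos I x t"
proof -
  have "bij_betw \<sigma> {i \<in> I. u * t \<le> u * x (\<sigma> i)} {j \<in> I. t \<le> x j}"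
    unfolding bij_betw_def
  proof
    show "inj_on \<sigma> {i \<in> I. u * t \<le> u * x (\<sigma> i)}"
      using permutes_inj[OF assms(1)] by (rule inj_on_subset) auto
    show "\<sigma> ` {i \<in> I. u * t \<le> u * x (\<sigma> i)} = {j \<in> I. t \<le> x j}"
    proof (intro equalityI subsetI)
      fix j assume "j \<in> {j \<in> I. t \<le> x j}"
      moreover from this obtain i where "i \<in> I" "j = \<sigma> i"
        using permutes_image[OF assms(1)] by blast
      ultimately show "j \<in> \<sigma> ` {i \<in> I. u * t \<le> u * x (\<sigma> i)}"
        using assms(2) by auto
    qed (use assms permutes_in_image[OF assms(1)] in auto)
  qed
  then show ?thesis unfolding n_pos_def by (rule bij_betw_same_card)
qed

lemma n_neg_eq_n_pos_uminus: "n_neg I w t = n_pos I (\<lambda>i. - w i) t"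
  unfolding n_neg_def n_pos_def by (rule arg_cong[where f = card]) auto

lemma n_neg_scaled_permutation:
  assumes "\<sigma> permutes I" "0 < u"
  shows "n_neg I (\<lambda>i. u * x (\<sigma> i)) (u * t) = n_neg I x t"
  using n_pos_scaled_permutation[OF assms, of "\<lambda>i. - x i" t] by (simp add: n_neg_eq_n_pos_uminus)

text \<open>The candidate \<open>\<bar>x j\<bar>\<close> is carried to
  \<open>u * \<bar>x j\<bar>\<close>, the magnitude at the index that \<open>\<sigma>\<close> sends
  to \<open>j\<close>. A negative factor would exchange \<open>n_pos\<close> and
  \<open>n_neg\<close>; it is covered by applying the lemma to the negated vector.\<close>

lemma candidates_scaled_permutation_nonempty:
  assumes "\<sigma> permutes I" "0 < u" "knockoff_plus_candidates I q x \<noteq> {}"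
  shows "knockoff_plus_candidates I q (\<lambda>i. u * x (\<sigma> i)) \<noteq> {}"
proof -
  obtain j where j: "j \<in> I" "0 < \<bar>x j\<bar>"
      "1 + real (n_neg I x \<bar>x j\<bar>) \<le> q * real (max (n_pos I x \<bar>x j\<bar>) 1)"
    using assms(3) unfolding knockoff_plus_candidates_nonempty_iff by blast
  then have "j \<in> \<sigma> ` I" using permutes_image[OF assms(1)] by simp
  then obtain i where i: "i \<in> I" "\<sigma> i = j" by blast
  have "\<bar>u * x (\<sigma> i)\<bar> = u * \<bar>x j\<bar>" using i(2) assms(2) by (simp add: abs_mult)
  then have "n_pos I (\<lambda>i. u * x (\<sigma> i)) \<bar>u * x (\<sigma> i)\<bar> = n_pos I x \<bar>x j\<bar>"
    "n_neg I (\<lambda>i. u * x (\<sigma> i)) \<bar>u * x (\<sigma> i)\<bar> = n_neg I x \<bar>x j\<bar>"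
    "0 < \<bar>u * x (\<sigma> i)\<bar>"
    using assms(2) j(2) unfolding \<open>\<bar>u * x (\<sigma> i)\<bar> = u * \<bar>x j\<bar>\<close>
    by (auto intro: n_pos_scaled_permutation[OF assms(1,2)] n_neg_scaled_permutation[OF assms(1,2)])
  then show ?thesis unfolding knockoff_plus_candidates_nonempty_iff
    using i(1) j(3) by (intro bexI[of _ i]) simp_all
qed

lemma exists_two_level_scores:
  fixes q :: real
  assumes "0 < q"
  shows "\<exists>(m::nat) (x :: nat \<Rightarrow> real). 2 \<le> m \<and> (\<forall>i\<in>{1..m}. x i \<noteq> 0) \<and>
    (\<Sum>i\<in>{1..m}. x i)\<^sup>2 = (\<Sum>i\<in>{1..m}. (x i)\<^sup>2) \<and>
    knockoff_plus_candidates {1..m} q x \<noteq> {} \<and>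
    knockoff_plus_candidates {1..m} q (\<lambda>i. - x i) \<noteq> {}"
proof -
  \<comment> \<open>\<open>b \<ge> 1 / q\<close> makes \<open>a\<close> a candidate for
    \<open>x\<close>, and \<open>n \<ge> (b + 1) / q\<close> makes 1 a candidate for the negated
    vector. The bound \<open>2 \<le> b\<close> keeps \<open>b * (b - 1)\<close> positive, and
    \<open>b \<le> n\<close> yields \<open>a > 1\<close>.\<close>
  define b where "b = max 2 (nat \<lceil>1 / q\<rceil>)"
  define n where "n = max b (nat \<lceil>(real b + 1) / q\<rceil>)"
  have b: "1 / q \<le> real b" "2 \<le> b"
    using real_nat_ceiling_ge[of "1 / q"] by (simp_all add: b_def)
  have n: "(real b + 1) / q \<le> real n" "b \<le> n"
    using real_nat_ceiling_ge[of "(real b + 1) / q"] by (simp_all add: n_def)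
  \<comment> \<open>The moment condition reads
    \<open>b * (b - 1) * a\<^sup>2 - 2 * b * n * a + n * (n - 1) = 0\<close>, and
    \<open>D\<^sup>2\<close> is a quarter of its discriminant.\<close>
  define D where "D = sqrt (real b * real n * (real b + real n - 1))"
  define a where "a = (real b * real n + D) / (real b * (real b - 1))"
  define x where "x i = (if i \<le> b then a else - 1)" for i :: nat
  define I where "I = {1..b + n}"
  have [simp]: "finite I" by (simp add: I_def)
  have D: "0 \<le> D" "D\<^sup>2 = real b * real n * (real b + real n - 1)"
    using b n by (simp_all add: D_def)
  have den: "0 < real b * (real b - 1)" using b by simp
  have "real b * (real b - 1) \<le> real b * real n" using n(2) by (intro mult_left_mono) auto
  moreover have "0 < D" using b n unfolding D_def by (intro real_sqrt_gt_zero mult_pos_pos) auto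
  ultimately have a1: "1 < a" using den by (simp add: a_def)
  have a_eq: "a * (real b * (real b - 1)) = real b * real n + D"
    using b(2) by (simp add: a_def)
  have I_split: "I = {1..b} \<union> {b<..b + n}" "{1..b} \<inter> {b<..b + n} = {}"
    by (auto simp: I_def)
  have sum_split: "(\<Sum>i\<in>I. f (x i)) = real b * f a + real n * f (- 1)" for f :: "real \<Rightarrow> real"
  proof -
    have "(\<Sum>i\<in>I. f (x i)) = (\<Sum>i\<in>{1..b}. f (x i)) + (\<Sum>i\<in>{b<..b + n}. f (x i))"
      unfolding I_split(1) using I_split(2) by (intro sum.union_disjoint) auto
    also have "\<dots> = (\<Sum>i\<in>{1..b}. f a) + (\<Sum>i\<in>{b<..b + n}. f (- 1))"
      by (intro arg_cong2[where f = "(+)"] sum.cong) (auto simp: x_def)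
    finally show ?thesis by simp
  qed
  \<comment> \<open>\<open>a\<close> is the larger root of this quadratic equation.\<close>
  have quadratic: "(real b * a - real n)\<^sup>2 = real b * a\<^sup>2 + real n"
  proof -
    have "(a * (real b * (real b - 1)) - real b * real n)\<^sup>2 = D\<^sup>2" using a_eq by simp
    then have "real b * (real b - 1) * ((real b * a - real n)\<^sup>2 - (real b * a\<^sup>2 + real n)) = 0"
      unfolding D(2) by (simp add: power2_eq_square algebra_simps)
    then show ?thesis using b(2) by auto
  qed
  \<comment> \<open>As \<open>a > 1\<close>, the entries \<open>- 1\<close> are still invisible at
    threshold \<open>a\<close>, so the ratio for \<open>x\<close> is \<open>1 / b\<close>. At
    threshold 1 every entry is visible, and the ratio for the negated vector is
    \<open>(1 + b) / n\<close>.\<close>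
  have pos_a: "{i \<in> I. a \<le> x i} = {1..b}" "{i \<in> I. x i \<le> - a} = {}"
    using a1 by (auto simp: I_def x_def)
  have neg_1: "{i \<in> I. x i \<le> - 1} = {b<..b + n}" "{i \<in> I. 1 \<le> x i} = {1..b}"
    using a1 by (auto simp: I_def x_def)
  have "knockoff_plus_candidates I q x \<noteq> {}"
    unfolding knockoff_plus_candidates_nonempty_iff
  proof (intro bexI[of _ 1] conjI)
    have "\<bar>x 1\<bar> = a" using a1 b by (simp add: x_def)
    then show "0 < \<bar>x 1\<bar>" "1 + real (n_neg I x \<bar>x 1\<bar>) \<le> q * real (max (n_pos I x \<bar>x 1\<bar>) 1)"
      using a1 b assms by (simp_all add: n_pos_def n_neg_def pos_a max_def field_simps)
    show "1 \<in> I" using b by (simp add: I_def)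
  qed
  moreover have "knockoff_plus_candidates I q (\<lambda>i. - x i) \<noteq> {}"
    unfolding knockoff_plus_candidates_nonempty_iff
  proof (intro bexI[of _ "b + n"] conjI)
    have "\<bar>- x (b + n)\<bar> = 1" using b n by (simp add: x_def)
    then show "0 < \<bar>- x (b + n)\<bar>"
        "1 + real (n_neg I (\<lambda>i. - x i) \<bar>- x (b + n)\<bar>)
          \<le> q * real (max (n_pos I (\<lambda>i. - x i) \<bar>- x (b + n)\<bar>) 1)"
      using b n assms by (simp_all add: n_pos_def n_neg_def neg_1 max_def field_simps)
    show "b + n \<in> I" using b by (simp add: I_def)
  qed
  moreover have "\<forall>i\<in>I. x i \<noteq> 0" using a1 by (auto simp: x_def)
  moreover have "(\<Sum>i\<in>I. x i)\<^sup>2 = (\<Sum>i\<in>I. (x i)\<^sup>2)"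
    using sum_split[of "\<lambda>y. y"] sum_split[of "\<lambda>y. y\<^sup>2"] quadratic by simp
  moreover have "2 \<le> b + n" using b by simp
  ultimately show ?thesis unfolding I_def by (intro exI[of _ "b + n"] exI[of _ x]) simp
qed

section \<open>The randomly permuted and scaled vector and its symmetries\<close>

definition scale_law :: "real measure" where
  "scale_law = uniform_measure lborel {-1..1}"

definition permutation_scale_law :: "nat set \<Rightarrow> ((nat \<Rightarrow> nat) \<times> real) measure" where
  "permutation_scale_law I = measure_pmf (pmf_of_set {\<sigma>. \<sigma> permutes I}) \<Otimes>\<^sub>M scale_law"

definition shuffled_score :: "(nat \<Rightarrow> real) \<Rightarrow> nat \<Rightarrow> (nat \<Rightarrow> nat) \<times> real \<Rightarrow> real" where
  "shuffled_score x i = (\<lambda>(\<sigma>, u). u * x (\<sigma> i))"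

text \<open>With the law pushed forward to functions, the scores are the coordinate projections,
  exactly as for the product measure.\<close>

definition shuffled_score_law :: "nat set \<Rightarrow> (nat \<Rightarrow> real) \<Rightarrow> (nat \<Rightarrow> real) measure" where
  "shuffled_score_law I x =
     distr (permutation_scale_law I) (PiM I (\<lambda>_. borel)) (\<lambda>p. \<lambda>i\<in>I. shuffled_score x i p)"

lemma sets_scale_law [simp, measurable_cong]: "sets scale_law = sets borel"
  by (simp add: scale_law_def)

lemma prob_space_scale_law: "prob_space scale_law"
  unfolding scale_law_def by (rule prob_space_uniform_measure) simp_all

text \<open>Lebesgue measure and the interval \<open>{-1..1}\<close> are both invariant under
  reflection.\<close>

lemma distr_scale_law_uminus: "distr scale_law borel uminus = scale_law"
proof (rule measure_eqI)
  fix X :: "real set" assume "X \<in> sets (distr scale_law borel uminus)"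
  then have X: "X \<in> sets borel" by simp
  have um: "(uminus :: real \<Rightarrow> real) -` X \<in> sets borel"
    using measurable_sets[of uminus borel borel X] X by simp
  have sp: "space scale_law = UNIV" by (simp add: scale_law_def)
  have "emeasure lborel ({-1..1} \<inter> X) = emeasure (distr lborel borel uminus) ({-1..1} \<inter> X)"
    by (simp add: lborel_distr_uminus)
  also have "\<dots> = emeasure lborel (uminus -` ({-1..1} \<inter> X))"
    using X by (subst emeasure_distr) auto
  also have "uminus -` ({-1..1} \<inter> X) = {-1..1::real} \<inter> uminus -` X" by auto
  finally have "emeasure lborel ({-1..1} \<inter> X) = emeasure lborel ({-1..1} \<inter> uminus -` X)" .
  moreover have "emeasure (distr scale_law borel uminus) X = emeasure scale_law (uminus -` X)"
    using X by (subst emeasure_distr) (auto simp: sp)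
  ultimately show "emeasure (distr scale_law borel uminus) X = emeasure scale_law X"
    using X um by (simp add: scale_law_def)
qed simp

lemma AE_scale_law_bounded: "AE u in scale_law. \<bar>u\<bar> \<le> 1"
  unfolding scale_law_def by (rule AE_uniform_measureI) auto

lemma AE_scale_law_neq: "AE u in scale_law. u \<noteq> c"
  unfolding scale_law_def by (rule AE_uniform_measureI) (auto intro: AE_mp[OF AE_lborel_singleton[of c]])

lemma prob_space_permutation_scale_law: "prob_space (permutation_scale_law I)"
proof -
  interpret prob_space scale_law by (rule prob_space_scale_law)
  interpret pair_prob_space "measure_pmf (pmf_of_set {\<sigma>. \<sigma> permutes I})" scale_law by unfold_locales
  show ?thesis unfolding permutation_scale_law_def by unfold_locales
qed

lemma sets_permutation_scale_law [measurable_cong]: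
  "sets (permutation_scale_law I) = sets (count_space UNIV \<Otimes>\<^sub>M borel)"
  unfolding permutation_scale_law_def by (intro sets_pair_measure_cong) auto

lemma shuffled_score_measurable [measurable]:
  "shuffled_score x i \<in> borel_measurable (permutation_scale_law I)"
proof -
  have [measurable]: "(\<lambda>p. x (fst p i)) \<in> borel_measurable (count_space UNIV \<Otimes>\<^sub>M borel)"
    by (rule measurable_compose[OF measurable_fst]) simp
  show ?thesis unfolding shuffled_score_def case_prod_beta by measurable
qed

lemma shuffled_vector_measurable:
  "(\<lambda>p. \<lambda>i\<in>I. shuffled_score x i p) \<in> measurable (permutation_scale_law I) (PiM I (\<lambda>_. borel))"
  by (intro measurable_restrict shuffled_score_measurable)

text \<open>The uniform law charges exactly the permutations of \<open>I\<close>, so almost surely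
  in \<open>\<sigma>\<close> means for each such permutation; null sets in the scale are then
  combined over the product.\<close>

lemma AE_permutation_scale_law:
  assumes "Measurable.pred (count_space UNIV \<Otimes>\<^sub>M borel) P" "finite I"
    and "\<And>\<sigma>. \<sigma> permutes I \<Longrightarrow> AE u in scale_law. P (\<sigma>, u)"
  shows "AE p in permutation_scale_law I. P p"
proof -
  interpret prob_space scale_law by (rule prob_space_scale_law)
  interpret pair_prob_space "measure_pmf (pmf_of_set {\<sigma>. \<sigma> permutes I})" scale_law by unfold_locales
  have "id permutes I" by (rule permutes_id)
  then have "set_pmf (pmf_of_set {\<sigma>. \<sigma> permutes I}) = {\<sigma>. \<sigma> permutes I}"
    using finite_permutations[OF assms(2)] by (intro set_pmf_of_set) blast+
  then have "AE \<sigma> in measure_pmf (pmf_of_set {\<sigma>. \<sigma> permutes I}). AE u in scale_law. P (\<sigma>, u)"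
    using assms(3) by (simp add: AE_measure_pmf_iff)
  moreover have "{p \<in> space (permutation_scale_law I). P p} \<in> sets (permutation_scale_law I)"
    using assms(1) by measurable
  ultimately show ?thesis
    unfolding permutation_scale_law_def by (intro AE_pair_measure) auto
qed

lemma permutation_scale_map_measurable:
  assumes "g \<in> borel_measurable borel"
  shows "(\<lambda>(\<sigma>, u). (f \<sigma>, g u)) \<in> measurable (permutation_scale_law I) (permutation_scale_law I)"
proof -
  have "(\<lambda>p. f (fst p)) \<in> measurable (count_space UNIV \<Otimes>\<^sub>M borel) (count_space UNIV)"
    by (rule measurable_compose[OF measurable_fst]) simp
  moreover have "(\<lambda>p. g (snd p)) \<in> borel_measurable (count_space UNIV \<Otimes>\<^sub>M borel)"
    using assms by (rule measurable_compose[OF measurable_snd])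
  ultimately show ?thesis
    unfolding case_prod_beta measurable_cong_sets[OF sets_permutation_scale_law sets_permutation_scale_law]
    by (rule measurable_Pair)
qed

text \<open>Covers both symmetries used below: composing \<open>\<sigma>\<close> with a fixed
  permutation gives exchangeability, and negating \<open>u\<close> gives a symmetric marginal. Each
  factor of the product is preserved separately.\<close>

lemma distr_permutation_scale_law:
  assumes "bij_betw f {\<sigma>. \<sigma> permutes I} {\<sigma>. \<sigma> permutes I}" "finite I"
    and "g \<in> borel_measurable borel" "distr scale_law borel g = scale_law"
  shows "distr (permutation_scale_law I) (permutation_scale_law I) (\<lambda>(\<sigma>, u). (f \<sigma>, g u))
    = permutation_scale_law I"
proof -
  interpret prob_space scale_law by (rule prob_space_scale_law)
  let ?P = "pmf_of_set {\<sigma>. \<sigma> permutes I}"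
  have "map_pmf f ?P = ?P"
    using map_pmf_of_set_bij_betw[OF assms(1)] finite_permutations[OF assms(2)] permutes_id by blast
  then have "distr (measure_pmf ?P) (count_space UNIV) f = measure_pmf ?P"
    by (metis map_pmf_rep_eq)
  moreover have "distr scale_law borel g = scale_law" by fact
  moreover have "distr (measure_pmf ?P) (count_space UNIV) f \<Otimes>\<^sub>M distr scale_law borel g
      = distr (measure_pmf ?P \<Otimes>\<^sub>M scale_law) (count_space UNIV \<Otimes>\<^sub>M borel) (\<lambda>(\<sigma>, u). (f \<sigma>, g u))"
    using assms(3,4) prob_space_scale_law
    by (intro pair_measure_distr) (auto simp: prob_space_imp_sigma_finite)
  ultimately have "permutation_scale_law I
      = distr (permutation_scale_law I) (count_space UNIV \<Otimes>\<^sub>M borel) (\<lambda>(\<sigma>, u). (f \<sigma>, g u))"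
    by (simp add: permutation_scale_law_def)
  also have "\<dots> = distr (permutation_scale_law I) (permutation_scale_law I) (\<lambda>(\<sigma>, u). (f \<sigma>, g u))"
    by (intro distr_cong sets_permutation_scale_law[symmetric]) auto
  finally show ?thesis ..
qed

lemma distr_permutation_scale_law_compose:
  assumes "\<pi> permutes I" "finite I"
  shows "distr (permutation_scale_law I) (permutation_scale_law I) (\<lambda>(\<sigma>, u). (\<sigma> \<circ> \<pi>, u))
    = permutation_scale_law I"
proof (rule distr_permutation_scale_law)
  have "inv \<pi> permutes I" using assms by (rule_tac permutes_inv)
  then show "bij_betw (\<lambda>\<sigma>. \<sigma> \<circ> \<pi>) {\<sigma>. \<sigma> permutes I} {\<sigma>. \<sigma> permutes I}"
    using assms(1) permutes_inv_o[OF assms(1)]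
    by (intro bij_betw_byWitness[where f' = "\<lambda>\<sigma>. \<sigma> \<circ> inv \<pi>"])
       (auto simp: o_assoc[symmetric] intro: permutes_compose)
  show "distr scale_law borel (\<lambda>u. u) = scale_law" by (rule distr_id2) simp
qed (use assms in simp_all)

lemma distr_permutation_scale_law_uminus:
  assumes "finite I"
  shows "distr (permutation_scale_law I) (permutation_scale_law I) (\<lambda>(\<sigma>, u). (\<sigma>, - u))
    = permutation_scale_law I"
  using assms distr_scale_law_uminus bij_betw_id
  by (intro distr_permutation_scale_law) (auto simp: id_def)

lemma prob_space_shuffled_score_law: "prob_space (shuffled_score_law I x)"
  unfolding shuffled_score_law_def
  by (intro prob_space.prob_space_distr prob_space_permutation_scale_law shuffled_vector_measurable)

lemma shuffled_coordinate_measurable: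
  "i \<in> I \<Longrightarrow> (\<lambda>\<omega>. \<omega> i) \<in> borel_measurable (shuffled_score_law I x)"
  unfolding shuffled_score_law_def by simp

lemma distr_shuffled_coordinate:
  assumes "i \<in> I"
  shows "distr (shuffled_score_law I x) borel (\<lambda>\<omega>. \<omega> i)
    = distr (permutation_scale_law I) borel (shuffled_score x i)"
  unfolding shuffled_score_law_def using assms
  by (subst distr_distr[OF _ shuffled_vector_measurable]) (auto simp: comp_def)

text \<open>Relabelling the coordinates by \<open>\<pi>\<close> amounts to replacing
  \<open>\<sigma>\<close> by \<open>\<sigma> \<circ> \<pi>\<close>, which preserves the underlying
  law.\<close>

lemma exchangeable_shuffled_scores:
  assumes "finite I"
  shows "exchangeable (shuffled_score_law I x) I (\<lambda>i \<omega>. \<omega> i)"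
  unfolding exchangeable_def
proof (intro allI impI)
  fix \<pi> assume \<pi>: "\<pi> permutes I"
  let ?B = "permutation_scale_law I" and ?b = "PiM I (\<lambda>_. borel :: real measure)"
  let ?F = "\<lambda>p. \<lambda>i\<in>I. shuffled_score x i p"
  have \<pi>I: "\<pi> i \<in> I" if "i \<in> I" for i using permutes_in_image[OF \<pi>] that by simp
  have law: "joint_law (shuffled_score_law I x) I (\<lambda>i \<omega>. \<omega> (\<tau> i))
      = distr ?B ?b (\<lambda>p. \<lambda>i\<in>I. shuffled_score x (\<tau> i) p)" if "\<And>i. i \<in> I \<Longrightarrow> \<tau> i \<in> I" for \<tau>
  proof -
    have "(\<lambda>\<omega>. \<lambda>i\<in>I. \<omega> (\<tau> i)) \<in> measurable ?b ?b"
      using that by (intro measurable_restrict measurable_component_singleton) auto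
    then show ?thesis unfolding joint_law_def shuffled_score_law_def
      using that by (subst distr_distr[OF _ shuffled_vector_measurable])
        (auto simp: comp_def intro!: distr_cong)
  qed
  have "distr ?B ?b ?F = distr (distr ?B ?B (\<lambda>(\<sigma>, u). (\<sigma> \<circ> \<pi>, u))) ?b ?F"
    by (simp add: distr_permutation_scale_law_compose[OF \<pi> assms])
  also have "\<dots> = distr ?B ?b (?F \<circ> (\<lambda>(\<sigma>, u). (\<sigma> \<circ> \<pi>, u)))"
    by (intro distr_distr shuffled_vector_measurable permutation_scale_map_measurable) simp
  also have "\<dots> = distr ?B ?b (\<lambda>p. \<lambda>i\<in>I. shuffled_score x (\<pi> i) p)"
    by (intro distr_cong) (auto simp: shuffled_score_def)
  finally show "joint_law (shuffled_score_law I x) I (\<lambda>i \<omega>. \<omega> (\<pi> i))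
      = joint_law (shuffled_score_law I x) I (\<lambda>i \<omega>. \<omega> i)"
    using law[of \<pi>, OF \<pi>I] law[of "\<lambda>i. i"] by simp
qed

section \<open>Mixed moments and marginals under exchangeability\<close>

lemma exchangeable_imp_pair_integral_eq:
  assumes "exchangeable M I W" "\<And>i. i \<in> I \<Longrightarrow> W i \<in> borel_measurable M"
    and "\<pi> permutes I" "i \<in> I" "j \<in> I" "f \<in> borel_measurable (borel \<Otimes>\<^sub>M borel)"
  shows "(\<integral>\<omega>. (f (W (\<pi> i) \<omega>, W (\<pi> j) \<omega>) :: real) \<partial>M) = (\<integral>\<omega>. f (W i \<omega>, W j \<omega>) \<partial>M)"
proof -
  let ?b = "PiM I (\<lambda>_. borel :: real measure)"
  have law: "(\<integral>v. f (v i, v j) \<partial>joint_law M I V) = (\<integral>\<omega>. f (V i \<omega>, V j \<omega>) \<partial>M)"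
    if "\<And>i. i \<in> I \<Longrightarrow> V i \<in> borel_measurable M" for V
  proof -
    have "(\<lambda>\<omega>. \<lambda>i\<in>I. V i \<omega>) \<in> measurable M ?b" using that by (intro measurable_restrict)
    moreover have "(\<lambda>v. f (v i, v j)) \<in> borel_measurable ?b"
      using assms(4-6) by measurable
    ultimately show ?thesis unfolding joint_law_def
      using assms(4,5) by (subst integral_distr) auto
  qed
  have "W (\<pi> k) \<in> borel_measurable M" if "k \<in> I" for k
    using assms(2) permutes_in_image[OF assms(3)] that by simp
  then show ?thesis
    using law[of "\<lambda>k. W (\<pi> k)"] law[of W] assms(1,2,3) by (simp add: exchangeable_def)
qed

text \<open>The first transposition sends \<open>i\<close> to \<open>k\<close> and \<open>j\<close>
  to some \<open>?j\<close> other than \<open>k\<close>. The second sends \<open>?j\<close> to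
  \<open>l\<close> and fixes \<open>k\<close>, since \<open>?j\<close> and \<open>l\<close> both
  differ from \<open>k\<close>.\<close>

lemma exists_permutation_pair:
  assumes "i \<in> I" "j \<in> I" "k \<in> I" "l \<in> I" "i \<noteq> j" "k \<noteq> l"
  shows "\<exists>\<pi>. \<pi> permutes I \<and> \<pi> i = k \<and> \<pi> j = l"
proof (intro exI conjI)
  let ?j = "Transposition.transpose i k j"
  have "?j \<in> I" "?j \<noteq> k"
    using assms by (auto simp: Transposition.transpose_def)
  then show "(Transposition.transpose ?j l \<circ> Transposition.transpose i k) permutes I"
    using assms by (intro permutes_compose permutes_swap_id)
  show "(Transposition.transpose ?j l \<circ> Transposition.transpose i k) i = k"
    using assms \<open>?j \<noteq> k\<close> by simp
  show "(Transposition.transpose ?j l \<circ> Transposition.transpose i k) j = l" by simp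
qed

text \<open>Permutations act transitively on ordered pairs of distinct indices, so all off-diagonal
  moments equal one number. By \<open>sq\<close> their sum vanishes, and it consists of
  \<open>card I * (card I - 1)\<close> copies of that number.\<close>

lemma exchangeable_product_integral_zero:
  assumes ex: "exchangeable M I W" and "finite I" and L2: "L2_score_vector M I W"
    and sq: "AE \<omega> in M. (\<Sum>i\<in>I. W i \<omega>)\<^sup>2 = (\<Sum>i\<in>I. (W i \<omega>)\<^sup>2)"
    and ij: "i \<in> I" "j \<in> I" "i \<noteq> j"
  shows "(\<integral>\<omega>. W i \<omega> * W j \<omega> \<partial>M) = 0"
proof -
  define c where "c k l = (\<integral>\<omega>. W k \<omega> * W l \<omega> \<partial>M)" for k l
  interpret prob_space M using L2 by (simp add: L2_score_vector_def)
  have meas: "W k \<in> borel_measurable M" and int_sq: "integrable M (\<lambda>\<omega>. (W k \<omega>)\<^sup>2)" if "k \<in> I" for k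
    using L2 that by (auto simp: L2_score_vector_def)
  have int: "integrable M (\<lambda>\<omega>. W k \<omega> * W l \<omega>)" if "k \<in> I" "l \<in> I" for k l
  proof (rule Bochner_Integration.integrable_bound[OF Bochner_Integration.integrable_add[OF int_sq[OF that(1)] int_sq[OF that(2)]]])
    show "(\<lambda>\<omega>. W k \<omega> * W l \<omega>) \<in> borel_measurable M" using meas that by simp
    have "\<bar>a * b\<bar> \<le> a\<^sup>2 + b\<^sup>2" for a b :: real
      using sum_squares_bound[of "\<bar>a\<bar>" "\<bar>b\<bar>"] mult_nonneg_nonneg[of "\<bar>a\<bar>" "\<bar>b\<bar>"]
      unfolding abs_mult power2_abs by linarith
    then show "AE \<omega> in M. norm (W k \<omega> * W l \<omega>) \<le> norm ((W k \<omega>)\<^sup>2 + (W l \<omega>)\<^sup>2)" by simp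
  qed
  have c_const: "c k l = c i j" if kl: "k \<in> I" "l \<in> I" "k \<noteq> l" for k l
  proof -
    obtain \<pi> where \<pi>: "\<pi> permutes I" "\<pi> i = k" "\<pi> j = l"
      using exists_permutation_pair[OF ij(1,2) kl(1,2) ij(3) kl(3)] by blast
    then show ?thesis
      using exchangeable_imp_pair_integral_eq[OF ex meas \<pi>(1) ij(1,2), of "\<lambda>(a, b). a * b"] \<pi>(2,3)
      by (simp add: c_def)
  qed
  have "(\<Sum>k\<in>I. \<Sum>l\<in>I. c k l) = (\<integral>\<omega>. (\<Sum>k\<in>I. W k \<omega>)\<^sup>2 \<partial>M)"
    unfolding c_def power2_eq_square sum_product
    using int by (simp add: Bochner_Integration.integral_sum Bochner_Integration.integrable_sum)
  also have "\<dots> = (\<integral>\<omega>. (\<Sum>k\<in>I. (W k \<omega>)\<^sup>2) \<partial>M)"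
    using sq meas by (intro integral_cong_AE) (auto intro!: borel_measurable_sum)
  also have "\<dots> = (\<Sum>k\<in>I. c k k)"
    unfolding c_def using int_sq by (simp add: Bochner_Integration.integral_sum power2_eq_square)
  finally have "(\<Sum>k\<in>I. \<Sum>l\<in>I. c k l) - (\<Sum>k\<in>I. c k k) = 0" by simp
  moreover have "(\<Sum>l\<in>I. c k l) - c k k = (\<Sum>l\<in>I - {k}. c i j)" if "k \<in> I" for k
  proof -
    have "(\<Sum>l\<in>I. c k l) = c k k + (\<Sum>l\<in>I - {k}. c k l)"
      using \<open>finite I\<close> that by (rule sum.remove)
    also have "(\<Sum>l\<in>I - {k}. c k l) = (\<Sum>l\<in>I - {k}. c i j)"
      using c_const that by (intro sum.cong) auto
    finally show ?thesis by simp
  qed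
  ultimately have "(\<Sum>k\<in>I. \<Sum>l\<in>I - {k}. c i j) = 0"
    by (simp add: sum_subtractf[symmetric])
  then have "real (card I) * (real (card I - 1) * c i j) = 0"
    using \<open>finite I\<close> by simp
  moreover have "card I \<noteq> 0" using \<open>finite I\<close> ij by auto
  moreover have "card I - 1 \<noteq> 0"
  proof -
    have "card {i, j} \<le> card I" using \<open>finite I\<close> ij by (intro card_mono) auto
    then show ?thesis using ij(3) by simp
  qed
  ultimately show ?thesis by (simp add: c_def)
qed

text \<open>A transposition swaps \<open>k\<close> and \<open>i\<close>; coordinate \<open>k\<close>
  is then read off both joint laws.\<close>

lemma exchangeable_imp_common_marginal:
  assumes "exchangeable M I W" "\<And>i. i \<in> I \<Longrightarrow> W i \<in> borel_measurable M" "k \<in> I"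
  shows "common_marginal M I W (distr M borel (W k))"
  unfolding common_marginal_def
proof
  fix i assume "i \<in> I"
  let ?b = "PiM I (\<lambda>_. borel :: real measure)"
  let ?\<pi> = "Transposition.transpose k i"
  have \<pi>: "?\<pi> permutes I" using assms(3) \<open>i \<in> I\<close> by (rule permutes_swap_id)
  have marg: "distr (joint_law M I V) borel (\<lambda>v. v k) = distr M borel (V k)"
    if "\<And>i. i \<in> I \<Longrightarrow> V i \<in> borel_measurable M" for V
    unfolding joint_law_def using that assms(3)
    by (subst distr_distr[OF _ measurable_restrict]) (auto simp: comp_def)
  have "W (?\<pi> j) \<in> borel_measurable M" if "j \<in> I" for j
    using assms(2) permutes_in_image[OF \<pi>] that by simp
  then show "distr M borel (W i) = distr M borel (W k)"
    using marg[of "\<lambda>j. W (?\<pi> j)"] marg[of W] assms(1,2) \<pi> by (simp add: exchangeable_def)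
qed

section \<open>Second moments, covariances and independence from the marginal law\<close>

lemma L2_score_vector_common_marginal:
  assumes "prob_space M" "\<And>i. i \<in> I \<Longrightarrow> W i \<in> borel_measurable M"
    and "common_marginal M I W \<mu>" "integrable \<mu> (\<lambda>y. y\<^sup>2)"
  shows "L2_score_vector M I W"
  unfolding L2_score_vector_def
proof (intro conjI ballI)
  fix i assume "i \<in> I"
  then have "integrable (distr M borel (W i)) (\<lambda>y. y\<^sup>2)"
    using assms(3,4) by (simp add: common_marginal_def)
  then show "integrable M (\<lambda>\<omega>. (W i \<omega>)\<^sup>2)"
    using assms(2)[OF \<open>i \<in> I\<close>] by (subst (asm) integrable_distr_eq) auto
qed (use assms in auto)

lemma integral_common_marginal:
  assumes "common_marginal M I W \<mu>" "i \<in> I" "W i \<in> borel_measurable M" "f \<in> borel_measurable borel"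
  shows "(\<integral>\<omega>. (f (W i \<omega>) :: real) \<partial>M) = (\<integral>y. f y \<partial>\<mu>)"
  using assms by (auto simp: common_marginal_def integral_distr[symmetric])

text \<open>Reflection makes the integral equal to its own negative; this also covers the default
  value 0 of a divergent integral.\<close>

lemma integral_symmetric_law_zero:
  assumes "symmetric_law \<mu>" "sets \<mu> = sets borel"
  shows "(\<integral>y. y \<partial>\<mu>) = 0"
proof -
  have "uminus \<in> measurable \<mu> (borel :: real measure)" using assms(2) by (simp cong: measurable_cong_sets)
  then have "(\<integral>y. y \<partial>distr \<mu> borel uminus) = (\<integral>y. - y \<partial>\<mu>)" by (subst integral_distr) auto
  then show ?thesis using assms(1) by (simp add: symmetric_law_def)
qed

lemma covariance_centered_common_marginal:
  assumes "common_marginal M I W \<mu>" "\<And>i. i \<in> I \<Longrightarrow> W i \<in> borel_measurable M"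
    and "symmetric_law \<mu>" "sets \<mu> = sets borel" "i \<in> I" "j \<in> I"
  shows "covariance M (W i) (W j) = (\<integral>\<omega>. W i \<omega> * W j \<omega> \<partial>M)"
  using integral_common_marginal[OF assms(1) _ assms(2), of _ "\<lambda>y. y"]
    integral_symmetric_law_zero[OF assms(3,4)] assms(5,6)
  by (simp add: covariance_def)

lemma indep_vars_PiM_components:
  assumes "I \<noteq> {}" "prob_space \<mu>" "sets \<mu> = sets borel"
  shows "prob_space.indep_vars (PiM I (\<lambda>_. \<mu>)) (\<lambda>_. borel) (\<lambda>i \<omega>. \<omega> i) I"
proof -
  let ?M = "PiM I (\<lambda>_. \<mu>)"
  interpret M: prob_space ?M by (intro prob_space_PiM assms)
  have comp: "(\<lambda>\<omega>. \<omega> i) \<in> borel_measurable ?M" if "i \<in> I" for i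
    using measurable_component_singleton[OF that, of "\<lambda>_. \<mu>"] assms(3) by (simp cong: measurable_cong_sets)
  have "distr ?M borel (\<lambda>\<omega>. \<omega> i) = \<mu>" if "i \<in> I" for i
    using distr_PiM_component[of I "\<lambda>_. \<mu>" i] assms that
    by (metis (no_types, lifting) distr_cong)
  then have "(\<Pi>\<^sub>M i\<in>I. distr ?M borel (\<lambda>\<omega>. \<omega> i)) = ?M" by (intro PiM_cong) auto
  \<comment> \<open>On the space of the product, restriction to \<open>I\<close> is the identity,
    and \<open>borel\<close> and \<open>\<mu>\<close> have the same measurable sets.\<close>
  moreover have "distr ?M (PiM I (\<lambda>_. borel)) (\<lambda>\<omega>. \<lambda>i\<in>I. \<omega> i) = distr ?M ?M (\<lambda>\<omega>. \<omega>)"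
    using assms(3) by (intro distr_cong sets_PiM_cong) (auto simp: space_PiM PiE_restrict)
  ultimately show ?thesis
    using assms(1) comp by (subst M.indep_vars_iff_distr_eq_PiM') (auto simp: distr_id)
qed

lemma (in prob_space) indep_vars_product_integral:
  fixes X :: "'i \<Rightarrow> 'a \<Rightarrow> real"
  assumes "indep_vars (\<lambda>_. borel) X I" "i \<in> I" "j \<in> I" "i \<noteq> j"
    and "integrable M (X i)" "integrable M (X j)"
  shows "(\<integral>\<omega>. X i \<omega> * X j \<omega> \<partial>M) = (\<integral>\<omega>. X i \<omega> \<partial>M) * (\<integral>\<omega>. X j \<omega> \<partial>M)"
proof -
  have "indep_vars (\<lambda>_. borel) X {i, j}"
    using assms by (intro indep_vars_subset[OF assms(1)]) auto
  then show ?thesis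
    using indep_vars_lebesgue_integral[of "{i, j}" X] assms(4-6) by auto
qed

section \<open>Almost sure properties of the shuffled scores\<close>

text \<open>Reduces boundedness, absence of atoms, the moment identity and the existence of a
  rejection to one fixed permutation and almost every scale.\<close>

lemma AE_shuffled_score_law:
  assumes "finite I" "Measurable.pred (PiM I (\<lambda>_. borel)) P"
    and "\<And>\<sigma>. \<sigma> permutes I \<Longrightarrow> AE u in scale_law. P (\<lambda>i\<in>I. u * x (\<sigma> i))"
  shows "AE \<omega> in shuffled_score_law I x. P \<omega>"
proof -
  have "Measurable.pred (permutation_scale_law I) (\<lambda>p. P (\<lambda>i\<in>I. shuffled_score x i p))"
    using shuffled_vector_measurable assms(2) by (rule measurable_compose)
  then have "AE p in permutation_scale_law I. P (\<lambda>i\<in>I. shuffled_score x i p)"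
    using assms(1,3)
    by (intro AE_permutation_scale_law)
       (simp_all add: shuffled_score_def cong: measurable_cong_sets[OF sets_permutation_scale_law])
  moreover have "{\<omega> \<in> space (PiM I (\<lambda>_. borel)). P \<omega>} \<in> sets (PiM I (\<lambda>_. borel :: real measure))"
    using assms(2) by measurable
  ultimately show ?thesis
    unfolding shuffled_score_law_def by (subst AE_distr_iff[OF shuffled_vector_measurable]) auto
qed

lemma shuffled_coordinate_square_integrable:
  assumes "finite I" "i \<in> I"
  shows "integrable (shuffled_score_law I x) (\<lambda>\<omega>. (\<omega> i)\<^sup>2)"
proof -
  interpret prob_space "shuffled_score_law I x" by (rule prob_space_shuffled_score_law)
  let ?C = "\<Sum>j\<in>I. \<bar>x j\<bar>"
  have "AE \<omega> in shuffled_score_law I x. \<bar>\<omega> i\<bar> \<le> ?C"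
  proof (rule AE_shuffled_score_law[OF assms(1)])
    show "Measurable.pred (PiM I (\<lambda>_. borel)) (\<lambda>\<omega>. \<bar>\<omega> i\<bar> \<le> ?C)" using assms(2) by measurable
    fix \<sigma> assume "\<sigma> permutes I"
    then have "\<sigma> i \<in> I" using permutes_in_image assms(2) by metis
    then have C: "\<bar>x (\<sigma> i)\<bar> \<le> ?C" using assms(1) by (intro member_le_sum) auto
    have "\<bar>u * x (\<sigma> i)\<bar> \<le> ?C" if "\<bar>u\<bar> \<le> 1" for u
      using mult_mono[OF that C] by (simp add: abs_mult)
    then show "AE u in scale_law. \<bar>(\<lambda>i\<in>I. u * x (\<sigma> i)) i\<bar> \<le> ?C"
      using AE_scale_law_bounded assms(2) by (auto elim!: eventually_mono)
  qed
  then have "AE \<omega> in shuffled_score_law I x. norm ((\<omega> i)\<^sup>2) \<le> ?C\<^sup>2"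
    by eventually_elim (simp add: abs_le_square_iff[symmetric])
  then show ?thesis
    using shuffled_coordinate_measurable[OF assms(2)]
    by (intro integrable_const_bound) auto
qed

text \<open>It suffices to exclude atoms. For fixed \<open>\<sigma>\<close>, the score hits
  \<open>a\<close> only at the single scale \<open>a / x (\<sigma> i)\<close>, where the nonzero
  entries of \<open>x\<close> enter.\<close>

lemma continuous_law_shuffled_coordinate:
  assumes "finite I" "i \<in> I" "\<And>j. j \<in> I \<Longrightarrow> x j \<noteq> 0"
  shows "continuous_law (distr (shuffled_score_law I x) borel (\<lambda>\<omega>. \<omega> i))" (is "continuous_law ?\<mu>")
proof -
  interpret N: prob_space "shuffled_score_law I x" by (rule prob_space_shuffled_score_law)
  note meas = shuffled_coordinate_measurable[OF assms(2), of x]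
  interpret \<mu>: real_distribution ?\<mu> using meas by (rule N.real_distribution_distr)
  have "measure ?\<mu> {a} = 0" for a
  proof -
    have "AE \<omega> in shuffled_score_law I x. \<omega> i \<noteq> a"
    proof (rule AE_shuffled_score_law[OF assms(1)])
      show "Measurable.pred (PiM I (\<lambda>_. borel)) (\<lambda>\<omega>. \<omega> i \<noteq> a)" using assms(2) by measurable
      fix \<sigma> assume "\<sigma> permutes I"
      then have "x (\<sigma> i) \<noteq> 0" using permutes_in_image assms(2,3) by metis
      then have "u * x (\<sigma> i) \<noteq> a" if "u \<noteq> a / x (\<sigma> i)" for u using that by auto
      then show "AE u in scale_law. (\<lambda>i\<in>I. u * x (\<sigma> i)) i \<noteq> a"
        using AE_scale_law_neq[of "a / x (\<sigma> i)"] assms(2) by (auto elim!: eventually_mono)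
    qed
    then have "AE y in ?\<mu>. y \<noteq> a" using meas by (subst AE_distr_iff) auto
    then have "\<mu>.prob {y \<in> space ?\<mu>. y = a} = 0"
      by (intro \<mu>.prob_eq_0_AE) simp
    then show ?thesis by simp
  qed
  then show ?thesis
    unfolding continuous_law_def by (simp add: continuous_at_imp_continuous_on \<mu>.isCont_cdf)
qed

lemma symmetric_law_shuffled_coordinate:
  assumes "finite I" "i \<in> I"
  shows "symmetric_law (distr (shuffled_score_law I x) borel (\<lambda>\<omega>. \<omega> i))"
proof -
  let ?B = "permutation_scale_law I" and ?X = "shuffled_score x i"
  have "distr ?B borel ?X = distr (distr ?B ?B (\<lambda>(\<sigma>, u). (\<sigma>, - u))) borel ?X"
    by (simp add: distr_permutation_scale_law_uminus[OF assms(1)])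
  also have "\<dots> = distr ?B borel (?X \<circ> (\<lambda>(\<sigma>, u). (\<sigma>, - u)))"
    by (intro distr_distr shuffled_score_measurable permutation_scale_map_measurable) simp
  also have "\<dots> = distr ?B borel (uminus \<circ> ?X)"
    by (intro distr_cong) (auto simp: shuffled_score_def)
  also have "\<dots> = distr (distr ?B borel ?X) borel uminus"
    by (subst distr_distr) auto
  finally show ?thesis
    unfolding symmetric_law_def distr_shuffled_coordinate[OF assms(2)] ..
qed

text \<open>Both sides are invariant under permutations and scale by the factor
  \<open>u\<^sup>2\<close>, so the identity for \<open>x\<close> carries over.\<close>

lemma AE_shuffled_square_sum:
  assumes "finite I" "(\<Sum>i\<in>I. x i)\<^sup>2 = (\<Sum>i\<in>I. (x i)\<^sup>2)"
  shows "AE \<omega> in shuffled_score_law I x. (\<Sum>i\<in>I. \<omega> i)\<^sup>2 = (\<Sum>i\<in>I. (\<omega> i)\<^sup>2)"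
proof (rule AE_shuffled_score_law[OF assms(1)])
  show "Measurable.pred (PiM I (\<lambda>_. borel)) (\<lambda>\<omega>. (\<Sum>i\<in>I. \<omega> i)\<^sup>2 = (\<Sum>i\<in>I. (\<omega> i)\<^sup>2 :: real))"
  proof -
    have s1: "(\<lambda>\<omega>. sum \<omega> I) \<in> borel_measurable (PiM I (\<lambda>_. borel :: real measure))"
      by (intro borel_measurable_sum measurable_component_singleton)
    have s2: "(\<lambda>\<omega>. \<Sum>i\<in>I. (\<omega> i)\<^sup>2) \<in> borel_measurable (PiM I (\<lambda>_. borel :: real measure))"
      by (intro borel_measurable_sum borel_measurable_power measurable_component_singleton)
    show ?thesis
      unfolding pred_def using borel_measurable_power[OF s1] s2 by (rule borel_measurable_eq)
  qed
  fix \<sigma> assume \<sigma>: "\<sigma> permutes I"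
  have "(\<Sum>i\<in>I. f (x (\<sigma> i))) = (\<Sum>i\<in>I. f (x i))" for f :: "real \<Rightarrow> real"
    using sum.permute[OF \<sigma>, of "\<lambda>i. f (x i)"] by (simp add: comp_def)
  from this[of "\<lambda>y. y"] this[of "\<lambda>y. y\<^sup>2"] assms(2)
  show "AE u in scale_law. (\<Sum>i\<in>I. (\<lambda>i\<in>I. u * x (\<sigma> i)) i)\<^sup>2 = (\<Sum>i\<in>I. ((\<lambda>i\<in>I. u * x (\<sigma> i)) i)\<^sup>2)"
    by (simp add: sum_distrib_left[symmetric] power_mult_distrib)
qed

text \<open>A positive \<open>u\<close> scales \<open>x\<close>, a negative one scales the negated
  vector by \<open>- u\<close>; either way a candidate survives. Only the null event
  \<open>u = 0\<close> is lost.\<close>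

lemma knockoff_plus_FDR_shuffled:
  assumes "finite I" "q < 1"
    and "knockoff_plus_candidates I q x \<noteq> {}" "knockoff_plus_candidates I q (\<lambda>i. - x i) \<noteq> {}"
  shows "knockoff_plus_FDR (shuffled_score_law I x) I I q (\<lambda>i \<omega>. \<omega> i) = 1"
proof -
  interpret prob_space "shuffled_score_law I x" by (rule prob_space_shuffled_score_law)
  let ?g = "\<lambda>\<omega>. of_bool (knockoff_plus_candidates I q \<omega> \<noteq> {}) :: real"
  have "?g \<in> borel_measurable (PiM I (\<lambda>_. borel))"
    using assms(1) by (intro candidates_nonempty_measurable measurable_component_singleton)
  then have pred: "Measurable.pred (PiM I (\<lambda>_. borel)) (\<lambda>\<omega>. ?g \<omega> = 1)" by measurable
  have g: "?g \<in> borel_measurable (shuffled_score_law I x)"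
    using candidates_nonempty_measurable[where w = "\<lambda>\<omega>. \<omega>"] assms(1) shuffled_coordinate_measurable by blast
  have "AE \<omega> in shuffled_score_law I x. ?g \<omega> = 1"
  proof (rule AE_shuffled_score_law[OF assms(1) pred])
    fix \<sigma> assume \<sigma>: "\<sigma> permutes I"
    have "knockoff_plus_candidates I q (\<lambda>i\<in>I. u * x (\<sigma> i)) \<noteq> {}" if "u \<noteq> 0" for u
    proof -
      have "knockoff_plus_candidates I q (\<lambda>i. u * x (\<sigma> i)) \<noteq> {}"
      proof (cases "0 < u")
        case True
        then show ?thesis using candidates_scaled_permutation_nonempty[OF \<sigma> _ assms(3)] by blast
      next
        case False
        then show ?thesis
          using candidates_scaled_permutation_nonempty[OF \<sigma> _ assms(4), of "- u"] that by simp
      qed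
      then show ?thesis
        using knockoff_plus_candidates_cong[of I "\<lambda>i\<in>I. u * x (\<sigma> i)" "\<lambda>i. u * x (\<sigma> i)" q] by simp
    qed
    then show "AE u in scale_law. ?g (\<lambda>i\<in>I. u * x (\<sigma> i)) = 1"
      using AE_scale_law_neq[of 0] by (auto elim!: eventually_mono)
  qed
  then have "(\<integral>\<omega>. ?g \<omega> \<partial>shuffled_score_law I x) = (\<integral>\<omega>. 1 \<partial>shuffled_score_law I x)"
    using g by (intro integral_cong_AE) auto
  then show ?thesis by (simp add: knockoff_plus_FDR_all_null[OF assms(1,2)] prob_space)
qed

section \<open>Comparison of the product law with the shuffled law\<close>

theorem proposition10:
  fixes q \<eta> :: real
  assumes "0 < q" and "q < 1" and "0 < \<eta>"
  shows "\<exists>(m::nat) (M :: (nat \<Rightarrow> real) measure) (V :: nat \<Rightarrow> (nat \<Rightarrow> real) \<Rightarrow> real)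
            (N :: (nat \<Rightarrow> real) measure) (W :: nat \<Rightarrow> (nat \<Rightarrow> real) \<Rightarrow> real) (\<mu> :: real measure).
     m \<ge> 1 \<and>
     L2_score_vector M {1..m} V \<and> L2_score_vector N {1..m} W \<and>
     common_marginal M {1..m} V \<mu> \<and> common_marginal N {1..m} W \<mu> \<and>
     continuous_law \<mu> \<and> symmetric_law \<mu> \<and>
     (\<forall>i\<in>{1..m}. \<forall>j\<in>{1..m}. covariance M (V i) (V j) = covariance N (W i) (W j)) \<and>
     prob_space.indep_vars M (\<lambda>_. borel) V {1..m} \<and>
     knockoff_plus_FDR M {1..m} {1..m} q V \<le> q \<and>
     exchangeable N {1..m} W \<and> pairwise_uncorrelated N {1..m} W \<and>
     knockoff_plus_FDR N {1..m} {1..m} q W > 1 - \<eta>"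
proof -
  obtain m :: nat and x :: "nat \<Rightarrow> real" where m: "2 \<le> m"
    and x0: "\<And>i. i \<in> {1..m} \<Longrightarrow> x i \<noteq> 0"
    and sq: "(\<Sum>i\<in>{1..m}. x i)\<^sup>2 = (\<Sum>i\<in>{1..m}. (x i)\<^sup>2)"
    and cand: "knockoff_plus_candidates {1..m} q x \<noteq> {}"
      "knockoff_plus_candidates {1..m} q (\<lambda>i. - x i) \<noteq> {}"
    using exists_two_level_scores[OF \<open>0 < q\<close>] by blast
  define I where "I = {1..m}"
  have I: "finite I" "I \<noteq> {}" "1 \<in> I" using m by (auto simp: I_def)
  define W :: "nat \<Rightarrow> (nat \<Rightarrow> real) \<Rightarrow> real" where "W = (\<lambda>i \<omega>. \<omega> i)"
  define N where "N = shuffled_score_law I x"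
  \<comment> \<open>The shuffled vector comes first; the independent one is the product of its
    marginal law, so the marginals agree by construction and the projections \<open>W\<close> serve
    both measures.\<close>
  define \<mu> where "\<mu> = distr N borel (W 1)"
  define M where "M = PiM I (\<lambda>_. \<mu>)"
  have W_N: "W i \<in> borel_measurable N" if "i \<in> I" for i
    using shuffled_coordinate_measurable[OF that] by (simp add: N_def W_def)
  interpret N: prob_space N unfolding N_def by (rule prob_space_shuffled_score_law)
  have \<mu>: "prob_space \<mu>" "sets \<mu> = sets borel"
    unfolding \<mu>_def using W_N[OF I(3)] by (auto intro: N.prob_space_distr)
  interpret M: prob_space M unfolding M_def by (intro prob_space_PiM \<mu>)
  have W_M: "W i \<in> borel_measurable M" if "i \<in> I" for i
    using measurable_component_singleton[OF that, of "\<lambda>_. \<mu>"] \<mu>(2)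
    unfolding M_def W_def by (simp cong: measurable_cong_sets)
  have ex: "exchangeable N I W"
    unfolding N_def W_def by (rule exchangeable_shuffled_scores[OF I(1)])
  have marg_N: "common_marginal N I W \<mu>"
    unfolding \<mu>_def using ex W_N I(3) by (rule exchangeable_imp_common_marginal)
  have marg_M: "common_marginal M I W \<mu>"
    unfolding common_marginal_def
  proof
    fix i assume "i \<in> I"
    have "distr M borel (W i) = distr M \<mu> (\<lambda>\<omega>. \<omega> i)"
      using \<mu>(2) by (intro distr_cong) (auto simp: W_def)
    then show "distr M borel (W i) = \<mu>"
      using distr_PiM_component[of I "\<lambda>_. \<mu>" i] \<mu>(1) \<open>i \<in> I\<close> by (simp add: M_def)
  qed
  have cont: "continuous_law \<mu>" and sym: "symmetric_law \<mu>"
    unfolding \<mu>_def N_def W_def using I x0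
    by (auto intro!: continuous_law_shuffled_coordinate symmetric_law_shuffled_coordinate simp: I_def)
  have "integrable N (\<lambda>\<omega>. (W 1 \<omega>)\<^sup>2)"
    unfolding N_def W_def using I by (intro shuffled_coordinate_square_integrable)
  then have "integrable \<mu> (\<lambda>y. y\<^sup>2)"
    unfolding \<mu>_def using W_N[OF I(3)] by (subst integrable_distr_eq) auto
  then have L2_M: "L2_score_vector M I W" and L2_N: "L2_score_vector N I W"
    using L2_score_vector_common_marginal M.prob_space_axioms N.prob_space_axioms W_M W_N marg_M marg_N
    by blast+
  have indep: "prob_space.indep_vars M (\<lambda>_. borel) W I"
    unfolding M_def W_def by (rule indep_vars_PiM_components[OF I(2) \<mu>])
  have cov_M: "covariance M (W i) (W j) = (\<integral>\<omega>. W i \<omega> * W j \<omega> \<partial>M)"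
    and cov_N: "covariance N (W i) (W j) = (\<integral>\<omega>. W i \<omega> * W j \<omega> \<partial>N)" if "i \<in> I" "j \<in> I" for i j
    using covariance_centered_common_marginal[OF marg_M W_M sym \<mu>(2) that]
      covariance_centered_common_marginal[OF marg_N W_N sym \<mu>(2) that] by blast+
  have "AE \<omega> in N. (\<Sum>i\<in>I. W i \<omega>)\<^sup>2 = (\<Sum>i\<in>I. (W i \<omega>)\<^sup>2)"
    unfolding N_def W_def using I(1) sq unfolding I_def by (rule AE_shuffled_square_sum)
  then have off_N: "covariance N (W i) (W j) = 0" if "i \<in> I" "j \<in> I" "i \<noteq> j" for i j
    unfolding cov_N[OF that(1,2)] using that
    by (rule exchangeable_product_integral_zero[OF ex I(1) L2_N])
  have int_M: "integrable M (W i)" if "i \<in> I" for i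
    using L2_M that by (simp add: L2_score_vector_def M.square_integrable_imp_integrable)
  have mean_M: "(\<integral>\<omega>. W i \<omega> \<partial>M) = 0" if "i \<in> I" for i
    using integral_common_marginal[OF marg_M that W_M[OF that], of "\<lambda>y. y"]
      integral_symmetric_law_zero[OF sym \<mu>(2)] by simp
  have "covariance M (W i) (W j) = 0" if "i \<in> I" "j \<in> I" "i \<noteq> j" for i j
    unfolding cov_M[OF that(1,2)] using M.indep_vars_product_integral[OF indep that] int_M mean_M that
    by simp
  \<comment> \<open>Variances depend only on the common marginal.\<close>
  moreover have "covariance M (W i) (W i) = covariance N (W i) (W i)" if "i \<in> I" for i
    unfolding cov_M[OF that that] cov_N[OF that that]
    using integral_common_marginal[OF marg_M that W_M[OF that], of "\<lambda>y. y * y"]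
      integral_common_marginal[OF marg_N that W_N[OF that], of "\<lambda>y. y * y"] by simp
  ultimately have cov: "covariance M (W i) (W j) = covariance N (W i) (W j)" if "i \<in> I" "j \<in> I" for i j
    using off_N that by (cases "i = j") auto
  have "knockoff_plus_FDR M I I q W \<le> q"
    unfolding M_def W_def using sym
    by (intro knockoff_plus_FDR_independent_symmetric_le assms I(1) \<mu>) (simp add: symmetric_law_def)
  \<comment> \<open>The value is exactly 1, and \<open>m\<close> and \<open>x\<close> depend only on
    \<open>q\<close>, so one construction serves every \<open>\<eta> > 0\<close>.\<close>
  moreover have "knockoff_plus_FDR N I I q W = 1"
    unfolding N_def W_def using I(1) \<open>q < 1\<close> cand by (intro knockoff_plus_FDR_shuffled) (auto simp: I_def)
  moreover have "pairwise_uncorrelated N I W"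
    using off_N by (simp add: pairwise_uncorrelated_def)
  ultimately have "1 \<le> m \<and> L2_score_vector M I W \<and> L2_score_vector N I W \<and>
     common_marginal M I W \<mu> \<and> common_marginal N I W \<mu> \<and> continuous_law \<mu> \<and> symmetric_law \<mu> \<and>
     (\<forall>i\<in>I. \<forall>j\<in>I. covariance M (W i) (W j) = covariance N (W i) (W j)) \<and>
     prob_space.indep_vars M (\<lambda>_. borel) W I \<and> knockoff_plus_FDR M I I q W \<le> q \<and>
     exchangeable N I W \<and> pairwise_uncorrelated N I W \<and> knockoff_plus_FDR N I I q W > 1 - \<eta>"
    using m L2_M L2_N marg_M marg_N cont sym cov indep ex \<open>0 < \<eta>\<close> by simp
  then show ?thesis unfolding I_def by blast
qed

end
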